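(* Let $(Y, d_Y)$ be a metric space. For all $k \in \mathbb{N}$ (with $k \ge 1$), let $h_k \colon Y \to Y$ be a homeomorphism, and for all $n \in \mathbb{N}$ define $$\mathscr{h}_n = h_n \circ h_{n-1} \circ \cdots \circ h_2 \circ h_1 .$$ For each $k$ let $V_k \subseteq Y$ be a subset such that $h_k$ is the identity on $V_k^c = Y \setminus V_k$. Suppose that (1) the $V_k$ satisfy $$\lim_{n\to\infty} \operatorname{diam}\Bigl(\bigcup_{k=n}^\infty V_k\Bigr) = 0;$$ (2) there exists a compact set $A \subseteq Y$ such that $$\bigcup_{k=1}^\infty V_k \subseteq A^\circ;$$ (3) the (pointwise) limit $\mathscr{h}_\infty = \lim_{n\to\infty} \mathscr{h}_n \colon Y \to Y$ exists and is bijective. Then $\mathscr{h}_\infty$ is a homeomorphism.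
   Context: $A^\circ$ denotes the interior of $A$ in $Y$, and $\operatorname{diam}$ denotes the diameter of a subset of $Y$ with respect to $d_Y$. The symbol $\mathscr{h}_n$ is just a name for the composite homeomorphism defined in the claim, and $\mathscr{h}_\infty(y) = \lim_{n\to\infty}\mathscr{h}_n(y)$ for each $y \in Y$. *)

theory Defs
  imports "HOL-Analysis.Analysis"
begin

text \<open>The sequence \<open>h\<close> is used from index 1 on: \<open>iter_comp h n\<close> is
  \<open>h n \<circ> \<dots> \<circ> h 2 \<circ> h 1\<close>; the value at \<open>n = 0\<close> is the empty composite.\<close>

primrec iter_comp :: "(nat \<Rightarrow> 'a \<Rightarrow> 'a) \<Rightarrow> nat \<Rightarrow> 'a \<Rightarrow> 'a" where
  "iter_comp h 0 = id"
| "iter_comp h (Suc n) = h (Suc n) \<circ> iter_comp h n"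

definition self_homeomorphism :: "('a::topological_space \<Rightarrow> 'a) \<Rightarrow> bool" where
  "self_homeomorphism f \<longleftrightarrow> (\<exists>g. homeomorphism UNIV UNIV f g)"

end

theory Submission imports Defs begin

text \<open>
  Two observations carry the proof. First, a bijection that fixes the complement of a set
  permutes that set (\<open>bij_fixing_complement\<close>). Hence once the orbit of a point under
  \<open>h (Suc n)\<close>, \<open>h (Suc (Suc n))\<close>, \dots meets the tail
  \<open>\<Union>k\<in>{Suc n..}. V k\<close> it stays there, and otherwise it never moves. So the composites after
  stage \<open>n\<close> displace every point by at most the diameter of this tail
  (\<open>dist_iter_comp_le\<close>). These diameters tend to 0, so the pointwise limit is a uniform
  limit of continuous maps and is therefore continuous.

  Second, the limit fixes every point outside \<open>\<Union>k\<in>{1..}. V k\<close>, in particular outside the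
  interior of the compact set \<open>A\<close>, and it permutes \<open>A\<close>. A continuous bijection of a compact
  Hausdorff space has a continuous inverse, so the inverse is continuous on \<open>A\<close>; on the
  closed complement of the interior of \<open>A\<close> it is the identity. These two closed sets cover
  the space, so the inverse is continuous (\<open>homeomorphism_of_compactly_supported_bij\<close>).
\<close>

lemma bij_fixing_complement:
  assumes "bij f" and fixes_outside: "\<And>x. x \<notin> S \<Longrightarrow> f x = x"
  shows "f ` S = S"
proof (intro equalityI subsetI)
  fix y assume "y \<in> f ` S"
  then obtain x where x: "x \<in> S" "y = f x" by blast
  show "y \<in> S"
  proof (rule ccontr)
    assume "y \<notin> S"
    then have "f y = f x" using fixes_outside x by simp
    then have "y = x" using \<open>bij f\<close> by (simp add: bij_is_inj inj_eq)
    with x \<open>y \<notin> S\<close> show False by simp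
  qed
next
  fix y assume "y \<in> S"
  obtain x where "y = f x" using \<open>bij f\<close> by (metis bij_is_surj surjD)
  with \<open>y \<in> S\<close> fixes_outside show "y \<in> f ` S" by (metis image_eqI)
qed

text \<open>The hypothesis that the support lies in the interior of \<open>A\<close>, and not just in
  \<open>A\<close>, makes the inverse equal to the identity on a closed set that together with
  \<open>A\<close> covers the space, so that the pasting lemma for two closed sets applies.\<close>

lemma homeomorphism_of_compactly_supported_bij:
  fixes f :: "'a::t2_space \<Rightarrow> 'a"
  assumes "bij f" and cont: "continuous_on UNIV f" and "compact A"
    and fixes_outside: "\<And>x. x \<notin> interior A \<Longrightarrow> f x = x"
  shows "homeomorphism UNIV UNIV f (inv f)"
proof -
  have inv_f: "inv f (f x) = x" for x
    using \<open>bij f\<close> by (simp add: bij_is_inj)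
  have "f ` A = A"
    using \<open>bij f\<close> fixes_outside interior_subset by (intro bij_fixing_complement) blast+
  moreover have "continuous_on (f ` A) (inv f)"
    using cont \<open>compact A\<close> inv_f by (intro continuous_on_inv) (auto intro: continuous_on_subset)
  ultimately have on_A: "continuous_on A (inv f)" by simp
  have "inv f y = y" if "y \<in> - interior A" for y
    using inv_f[of y] fixes_outside that by simp
  then have on_outside: "continuous_on (- interior A) (inv f)"
    by (subst continuous_on_cong[OF refl, where g = "\<lambda>y. y"]) auto
  have "A \<union> - interior A = UNIV" using interior_subset by blast
  then have "continuous_on UNIV (inv f)"
    using continuous_on_closed_Un[OF _ _ on_A on_outside] \<open>compact A\<close>
    by (simp add: compact_imp_closed closed_Compl)
  then show ?thesis
    using cont \<open>bij f\<close> inv_f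
    by (simp add: homeomorphism_def bij_is_surj bij_imp_bij_inv surj_f_inv_f)
qed

lemma self_homeomorphism_imp_bij:
  assumes "self_homeomorphism f"
  shows "bij f"
  using assms unfolding self_homeomorphism_def homeomorphism_def
  by (metis UNIV_I bijI')

lemma continuous_on_iter_comp:
  fixes h :: "nat \<Rightarrow> 'a::topological_space \<Rightarrow> 'a"
  assumes "\<And>k. k \<ge> 1 \<Longrightarrow> continuous_on UNIV (h k)"
  shows "continuous_on UNIV (iter_comp h n)"
proof (induction n)
  case 0
  then show ?case by (simp add: continuous_on_id)
next
  case (Suc n)
  moreover have "continuous_on (range (iter_comp h n)) (h (Suc n))"
    using assms[of "Suc n"] by (auto intro: continuous_on_subset)
  ultimately show ?case unfolding iter_comp.simps by (rule continuous_on_compose)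
qed

lemma iter_comp_unmoved:
  assumes supp: "\<And>k y. k \<ge> 1 \<Longrightarrow> y \<notin> V k \<Longrightarrow> h k y = y"
    and "n \<le> m" and "iter_comp h n x \<notin> (\<Union>k\<in>{Suc n..}. V k)"
  shows "iter_comp h m x = iter_comp h n x"
  using \<open>n \<le> m\<close>
proof (induction m rule: dec_induct)
  case (step m)
  then have "iter_comp h n x \<notin> V (Suc m)" using assms(3) by auto
  then show ?case using step supp by simp
qed simp

lemma iter_comp_trapped:
  assumes bij: "\<And>k. k \<ge> 1 \<Longrightarrow> bij (h k)"
    and supp: "\<And>k y. k \<ge> 1 \<Longrightarrow> y \<notin> V k \<Longrightarrow> h k y = y"
    and "n \<le> m" and start: "iter_comp h n x \<in> (\<Union>k\<in>{Suc n..}. V k)" (is "_ \<in> ?W")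
  shows "iter_comp h m x \<in> ?W"
  using \<open>n \<le> m\<close>
proof (induction m rule: dec_induct)
  case base
  show ?case by (rule start)
next
  case (step m)
  have "V (Suc m) \<subseteq> ?W" using \<open>n \<le> m\<close> by auto
  then have "h (Suc m) ` ?W = ?W"
    using bij[of "Suc m"] supp[of "Suc m"] by (intro bij_fixing_complement) auto
  then show ?case using step.IH by auto
qed

lemma dist_iter_comp_le:
  fixes h :: "nat \<Rightarrow> 'a::metric_space \<Rightarrow> 'a"
  assumes "\<And>k. k \<ge> 1 \<Longrightarrow> bij (h k)"
    and "\<And>k y. k \<ge> 1 \<Longrightarrow> y \<notin> V k \<Longrightarrow> h k y = y"
    and "n \<le> m" and bdd: "bounded (\<Union>k\<in>{Suc n..}. V k)"
  shows "dist (iter_comp h n x) (iter_comp h m x) \<le> diameter (\<Union>k\<in>{Suc n..}. V k)"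
proof (cases "iter_comp h n x \<in> (\<Union>k\<in>{Suc n..}. V k)")
  case True
  moreover have "iter_comp h m x \<in> (\<Union>k\<in>{Suc n..}. V k)"
    using assms(1-3) True by (rule iter_comp_trapped)
  ultimately show ?thesis by (rule diameter_bounded_bound[OF bdd])
next
  case False
  then have "iter_comp h m x = iter_comp h n x"
    using assms(2,3) by (intro iter_comp_unmoved)
  then show ?thesis by (simp add: diameter_ge_0[OF bdd])
qed

theorem theorem3p3:
  fixes h :: "nat \<Rightarrow> 'a::metric_space \<Rightarrow> 'a"
    and V :: "nat \<Rightarrow> 'a set"
    and h_inf :: "'a \<Rightarrow> 'a"
  assumes homeo: "\<And>k. k \<ge> 1 \<Longrightarrow> self_homeomorphism (h k)"
    and supp: "\<And>k y. k \<ge> 1 \<Longrightarrow> y \<in> - V k \<Longrightarrow> h k y = y"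
    and diam: "(\<lambda>n. diameter (\<Union>k\<in>{n..}. V k)) \<longlonglongrightarrow> 0"
    and cpt: "\<exists>A. compact A \<and> (\<Union>k\<in>{1..}. V k) \<subseteq> interior A"
    and lim: "\<And>y. (\<lambda>n. iter_comp h n y) \<longlonglongrightarrow> h_inf y"
    and bij: "bij h_inf"
  shows "self_homeomorphism h_inf"
proof -
  let ?W = "\<lambda>n. \<Union>k\<in>{n..}. V k"
  obtain A where A: "compact A" "?W 1 \<subseteq> interior A" using cpt by blast
  have supp': "h k y = y" if "k \<ge> 1" "y \<notin> V k" for k y
    using supp that by simp
  have bij_h: "bij (h k)" if "k \<ge> 1" for k
    using homeo[OF that] by (rule self_homeomorphism_imp_bij)
  have cont_h: "continuous_on UNIV (h k)" if "k \<ge> 1" for k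
    using homeo[OF that] by (auto simp: self_homeomorphism_def homeomorphism_def)

  \<comment> \<open>Without boundedness, \<open>diameter\<close> would be the supremum of an unbounded set of reals
    and would bound no distances.\<close>
  have bdd: "bounded (?W (Suc n))" for n
  proof (rule bounded_subset)
    show "bounded A" using A by (simp add: compact_imp_bounded)
    have "?W (Suc n) \<subseteq> ?W 1" by (intro UN_mono) auto
    then show "?W (Suc n) \<subseteq> A" using A interior_subset by blast
  qed

  have dist_lim: "dist (iter_comp h n x) (h_inf x) \<le> diameter (?W (Suc n))" for n x
  proof (rule tendsto_upperbound)
    show "(\<lambda>m. dist (iter_comp h n x) (iter_comp h m x)) \<longlonglongrightarrow> dist (iter_comp h n x) (h_inf x)"
      by (intro tendsto_intros lim)
    show "\<forall>\<^sub>F m in sequentially. dist (iter_comp h n x) (iter_comp h m x) \<le> diameter (?W (Suc n))"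
      using dist_iter_comp_le[OF bij_h supp' _ bdd] by (intro eventually_sequentiallyI)
  qed simp
  have "uniform_limit UNIV (iter_comp h) h_inf sequentially"
  proof (rule uniform_limitI)
    fix e :: real assume "e > 0"
    have "(\<lambda>n. diameter (?W (Suc n))) \<longlonglongrightarrow> 0" using diam by (rule LIMSEQ_Suc)
    then have "\<forall>\<^sub>F n in sequentially. diameter (?W (Suc n)) < e"
      using \<open>e > 0\<close> by (rule order_tendstoD)
    then show "\<forall>\<^sub>F n in sequentially. \<forall>x\<in>UNIV. dist (iter_comp h n x) (h_inf x) < e"
      by eventually_elim (auto intro: le_less_trans[OF dist_lim])
  qed
  then have cont: "continuous_on UNIV h_inf"
    using continuous_on_iter_comp[of h, OF cont_h]
    by (intro uniform_limit_theorem[where F = sequentially]) auto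

  have "h_inf x = x" if "x \<notin> interior A" for x
  proof -
    have "x \<notin> ?W (Suc 0)" using A that by auto
    then have "iter_comp h n x = x" for n
      using iter_comp_unmoved[OF supp', where n = 0 and m = n and x = x] by simp
    then show ?thesis using lim[of x] by (simp add: LIMSEQ_const_iff)
  qed
  then have "homeomorphism UNIV UNIV h_inf (inv h_inf)"
    using bij cont A by (intro homeomorphism_of_compactly_supported_bij)
  then show ?thesis unfolding self_homeomorphism_def by blast
qed

end
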